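(* Let $d\geq 1$ be an integer, let $r\geq 1$, and let $1 \leq p,q \leq \infty$ satisfy $\frac{1}{p} + \frac{1}{q}=\frac{\log_2(2+2^r)}{r}$. Then $$\|f*f\|_{\ell^r(\mathbb{Z}^d)}\leq \|f\|_{\ell^p(\mathbb{Z}^d)}\, \|f\|_{\ell^q(\mathbb{Z}^d)}$$ holds for all $f:\mathbb{Z}^d\to \mathbb{R}$ supported in $\{0,1\}^d$.
   Context: A function $f:\mathbb{Z}^d\to\mathbb{R}$ is supported in $\{0,1\}^d$ if $f(x)=0$ for all $x\notin\{0,1\}^d$. Convolution: $(f*g)(x)=\sum_{y\in\mathbb{Z}^d} f(y)g(x-y)$. Norms: $\|f\|_{\ell^p(\mathbb{Z}^d)}=\big(\sum_{x\in\mathbb{Z}^d}|f(x)|^p\big)^{1/p}$ for $0<p<\infty$, and $\|f\|_{\ell^\infty(\mathbb{Z}^d)}=\sup_x|f(x)|$; the convention $1/\infty=0$ is used. *)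

theory Defs
  imports "HOL-Analysis.Analysis"
begin

definition unit_cube :: "(int ^ 'd) set" where
  "unit_cube = {x. \<forall>i. x $ i \<in> {0, 1}}"

definition supported_in :: "('a \<Rightarrow> real) \<Rightarrow> 'a set \<Rightarrow> bool" where
  "supported_in f S \<longleftrightarrow> (\<forall>x. x \<notin> S \<longrightarrow> f x = 0)"

text \<open>The series below is finite as soon as \<open>f\<close> or \<open>g\<close> has finite support; \<open>infsum\<close> returns 0 when
  the family is not summable.\<close>

definition convolution :: "(int ^ 'd \<Rightarrow> real) \<Rightarrow> (int ^ 'd \<Rightarrow> real) \<Rightarrow> int ^ 'd \<Rightarrow> real" where
  "convolution f g x = (\<Sum>\<^sub>\<infinity>y. f y * g (x - y))"

text \<open>Exponents range over \<open>0 < p \<le> \<infinity>\<close>; the norm is extended-valued, so that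
  functions outside \<open>\<ell>\<^sup>p\<close> have norm \<open>\<infinity>\<close>.\<close>

definition lp_norm :: "ereal \<Rightarrow> (int ^ 'd \<Rightarrow> real) \<Rightarrow> ereal" where
  "lp_norm p f =
     (if p = \<infinity> then (SUP x. ereal \<bar>f x\<bar>)
      else if (\<lambda>x. \<bar>f x\<bar> powr real_of_ereal p) summable_on UNIV
      then ereal ((\<Sum>\<^sub>\<infinity>x. \<bar>f x\<bar> powr real_of_ereal p) powr (1 / real_of_ereal p))
      else \<infinity>)"

end

theory Submission
  imports Defs
begin

text \<open>
  Put \<open>s = log 2 (2 + 2 powr r)\<close> and \<open>t = 2 * r / s\<close>, so that \<open>1 / p + 1 / q = 2 / t\<close>. By log-convexity of
  the \<open>\<ell>\<^sup>p\<close> norms (\<open>lp_norm_interpolation\<close>), the product of the \<open>\<ell>\<^sup>p\<close> and \<open>\<ell>\<^sup>q\<close> norms of \<open>f\<close> is at least the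
  square of its \<open>\<ell>\<^sup>t\<close> norm; it therefore suffices to treat \<open>p = q = t\<close>.

  The inequality is then proved in the bilinear form, in which the \<open>\<ell>\<^sup>r\<close> norm of \<open>f * g\<close> is at most the
  product of the \<open>\<ell>\<^sup>t\<close> norms of \<open>f\<close> and \<open>g\<close>, for nonnegative \<open>f\<close> and \<open>g\<close> on the cube. This form
  tensorizes: slicing along one coordinate, the triangle inequality in \<open>\<ell>\<^sup>r\<close> and the bound for the
  slices reduce it to dimension one (\<open>convolution_bound_shift_union\<close>). The bilinear form is needed even
  when \<open>f = g\<close>, because the two slices of \<open>f\<close> get convolved with each other.

  In dimension one, dividing by the geometric mean of the products involved, the inequality reads
  \<open>z powr r + z powr (- r) + (x + 1 / x) powr r
    \<le> (z powr t + z powr (- t) + x powr t + x powr (- t)) powr (s / 2)\<close>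
  with two independent parameters \<open>z\<close> and \<open>x\<close>, and with equality for \<open>z = x = 1\<close>. For fixed \<open>x\<close> the
  difference of the two sides is monotone on either side of \<open>z = 1\<close> (\<open>powr_reciprocal_sum_le\<close>), which
  leaves the case \<open>z = 1\<close>. There, monotonicity in \<open>x\<close> of the suitably normalised difference
  (\<open>two_add_powr_le\<close>) comes down to
  \<open>(1 - a powr c) * (1 + a powr c) powr (r - 1) \<le> (1 - a) * (1 + a) powr (s - 1)\<close> for \<open>0 \<le> a \<le> 1\<close> and
  \<open>c = s / r\<close> (\<open>powr_exponent_tradeoff\<close>), which follows by logarithmic differentiation.
  In the lemmas on the two-point inequality and its tensorization, the exponent \<open>t\<close> is called \<open>p\<close>.
\<close>

section \<open>Elementary inequalities for real powers\<close>

lemma powr_bernoulli: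
  fixes m y :: real
  assumes "1 \<le> m" "0 \<le> y"
  shows "1 + m * (y - 1) \<le> y powr m"
proof (cases "y = 0")
  case True
  then show ?thesis using assms by simp
next
  case False
  have "(y powr m) powr (1/m) * 1 powr (1 - 1/m) \<le> 1/m * y powr m + (1 - 1/m) * 1"
    using assms False by (intro Youngs_inequality_0) auto
  then have "y \<le> 1/m * y powr m + (1 - 1/m)"
    using assms by (simp add: powr_powr)
  then have "m * y \<le> m * (1/m * y powr m + (1 - 1/m))"
    using assms by (intro mult_left_mono) auto
  then show ?thesis
    using assms by (simp add: algebra_simps)
qed

lemma powr_superadditive:
  fixes k x y :: real
  assumes "1 \<le> k" "0 \<le> x" "0 \<le> y"
  shows "x powr k + y powr k \<le> (x + y) powr k"
proof (cases "x + y = 0")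
  case True
  then have "x = 0" "y = 0" using assms by auto
  then show ?thesis by simp
next
  case False
  define w where "w = x + y"
  have w: "0 < w" using False assms by (simp add: w_def)
  have *: "(t / w) powr k \<le> t / w" if "0 \<le> t" "t \<le> w" for t
    using powr_mono'[of 1 k "t / w"] that w assms by (simp add: divide_simps)
  have "(x / w) powr k + (y / w) powr k \<le> x / w + y / w"
    using assms by (intro add_mono *) (auto simp: w_def)
  also have "\<dots> = 1"
    using w by (simp add: w_def add_divide_distrib[symmetric])
  finally show ?thesis
    using w assms by (simp add: powr_divide add_divide_distrib[symmetric] w_def)
qed

text \<open>For real \<open>m \<ge> 1\<close>. Bernoulli's inequality at \<open>1 + 1/z\<close> gives
  \<open>(z + 1) powr m \<ge> z powr m + m * z powr (m - 1)\<close>, and Bernoulli's inequality at \<open>1/z\<close> shows that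
  this lower bound suffices.\<close>

lemma powr_Suc_minus_one_le:
  fixes m z :: real
  assumes "1 \<le> m" "1 \<le> z"
  shows "z powr (m + 1) - 1 \<le> (z - 1) * (z + 1) powr m"
proof -
  have z: "0 < z" using assms by simp
  have "1 + m * (1 + 1/z - 1) \<le> (1 + 1/z) powr m"
    using assms by (intro powr_bernoulli) (auto simp: add_pos_pos)
  also have "\<dots> = (z + 1) powr m / z powr m"
    using z by (simp add: powr_divide[symmetric] add_divide_distrib)
  finally have 1: "z powr m * (1 + m / z) \<le> (z + 1) powr m"
    using z by (simp add: field_simps)
  have "1 + m * (1/z - 1) \<le> (1/z) powr m"
    using assms by (intro powr_bernoulli) auto
  then have "z powr m * (1 + m * (1/z - 1)) \<le> 1"
    using z by (simp add: powr_divide field_simps)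
  then have "z powr (m + 1) - 1 \<le> (z - 1) * (z powr m * (1 + m / z))"
    using z by (simp add: powr_add field_simps)
  also have "\<dots> \<le> (z - 1) * (z + 1) powr m"
    using 1 assms by (intro mult_left_mono) auto
  finally show ?thesis .
qed

text \<open>The right-hand side minus the left-hand side is nondecreasing in \<open>Z \<ge> 1\<close>, so that the
  inequality need only be known at \<open>Z = 1\<close>. By monotonicity in \<open>L\<close> of the derivative, it is enough to
  treat \<open>L = 2\<close>, where the claim becomes the preceding lemma with \<open>m = 2 * k - 1\<close>.\<close>

lemma powr_reciprocal_sum_le_ge1:
  fixes k L Z K :: real
  assumes k: "1 \<le> k" and L: "2 \<le> L" and Z: "1 \<le> Z" and K: "2 + K \<le> (2 + L) powr k"
  shows "Z powr k + Z powr (-k) + K \<le> (Z + 1 / Z + L) powr k"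
proof -
  define F where "F = (\<lambda>Z. (Z + 1 / Z + L) powr k - Z powr k - Z powr (-k))"
  have "F 1 \<le> F Z"
  proof (rule DERIV_nonneg_imp_nondecreasing[OF Z], goal_cases)
    case (1 x)
    then have x: "0 < x" by simp
    define b where "b = x + 1 / x + L"
    have b: "0 < b" using x L by (simp add: b_def add_pos_pos)
    let ?D = "k * b powr (k - 1) * (1 - 1 / x^2) - k * x powr (k - 1) + k * x powr (-k - 1)"
    have "((\<lambda>Z. Z + 1 / Z + L) has_real_derivative 1 - 1 / x^2) (at x)"
      using x by (auto intro!: derivative_eq_intros simp: power2_eq_square)
    from DERIV_fun_powr[OF this, of k]
    have d: "((\<lambda>Z. (Z + 1 / Z + L) powr k) has_real_derivative k * b powr (k - 1) * (1 - 1 / x^2)) (at x)"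
      using b by (simp add: b_def)
    have "(F has_real_derivative k * b powr (k - 1) * (1 - 1 / x^2) - k * x powr (k - 1) - (-k) * x powr (-k - 1)) (at x)"
      unfolding F_def using x by (intro DERIV_diff d has_real_derivative_powr)
    then have "(F has_real_derivative ?D) (at x)" by simp
    moreover have "0 \<le> ?D"
    proof -
      \<comment> \<open>Up to the factor \<open>k\<close>, this says that the derivative is nonnegative for \<open>L = 2\<close>.\<close>
      have *: "x powr (-k-1) * (x powr (2 * k - 1 + 1) - 1) \<le> x powr (-k-1) * ((x - 1) * (x + 1) powr (2 * k - 1))"
        using powr_Suc_minus_one_le[of "2 * k - 1" x] k 1 by (intro mult_left_mono) auto
      have "x powr (k - 1) - x powr (-k - 1) = x powr (-k-1) * (x powr (2 * k - 1 + 1) - 1)"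
        by (simp add: right_diff_distrib powr_add[symmetric])
      also note *
      also have "x powr (-k-1) * ((x - 1) * (x + 1) powr (2 * k - 1)) = (x + 1 / x + 2) powr (k - 1) * (1 - 1 / x^2)"
      proof -
        have "x + 1 / x + 2 = (x + 1)^2 / x"
          using x by (simp add: field_simps power2_eq_square)
        then have "(x + 1 / x + 2) powr (k - 1) = (x+1) powr (2 * (k - 1)) * x powr (-(k-1))"
          using x powr_powr[of "x + 1" 2 "k - 1"] powr_minus_divide[of x "k - 1"]
          by (simp add: powr_divide)
        moreover have "(x + 1) powr (2 * k - 1) = (x + 1) powr (2 * (k - 1)) * (x + 1)"
          using x powr_add[of "x+1" "2*(k-1)" 1] by (simp add: algebra_simps)
        moreover have "x powr (-k-1) = x powr (-(k-1)) / x^2"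
        proof -
          have "-k-1 = -(k-1) - 2" by simp
          then show ?thesis using x by (simp only: powr_diff) simp
        qed
        moreover have "1 - 1/x^2 = (x - 1) * (x + 1) / x^2"
          using x by (simp add: field_simps power2_eq_square)
        ultimately show ?thesis by simp
      qed
      also have "\<dots> \<le> b powr (k - 1) * (1 - 1 / x^2)"
        using x 1 k L unfolding b_def
        by (intro mult_right_mono powr_mono2) (auto simp: divide_simps)
      finally have "k * (x powr (k - 1) - x powr (-k - 1)) \<le> k * (b powr (k - 1) * (1 - 1 / x^2))"
        using k by (intro mult_left_mono) auto
      then show ?thesis by (simp add: algebra_simps)
    qed
    ultimately show ?case by blast
  qed
  then show ?thesis using K by (simp add: F_def)
qed

lemma powr_reciprocal_sum_le:
  fixes k L Z K :: real
  assumes k: "1 \<le> k" and L: "2 \<le> L" and Z: "0 < Z" and K: "2 + K \<le> (2 + L) powr k"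
  shows "Z powr k + Z powr (-k) + K \<le> (Z + 1 / Z + L) powr k"
proof (cases "1 \<le> Z")
  case True
  then show ?thesis using assms powr_reciprocal_sum_le_ge1 by blast
next
  case False
  then have "1 \<le> 1 / Z" using Z by simp
  from powr_reciprocal_sum_le_ge1[OF k L this K] show ?thesis
    using Z by (simp add: powr_minus powr_divide add_ac field_simps)
qed

section \<open>The two-point inequality\<close>

text \<open>As a function of \<open>c\<close>, the left-hand side is convex on \<open>[1, 2]\<close>, and the right-hand side is its
  chord through \<open>c = 1\<close> and \<open>c = 2\<close>.\<close>

lemma powr_diff_chord:
  fixes a c :: real
  assumes "0 < a" "a \<le> 1" "1 \<le> c" "c \<le> 2"
  shows "a powr (2 - c) - a powr c \<le> (c - 1) * (1 - a^2)"
proof -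
  define l where "l = ln a"
  define f where "f = (\<lambda>c. exp ((2 - c) * l) - exp (c * l))"
  have l: "l \<le> 0" using assms by (simp add: l_def)
  have "convex_on {1..2} f"
  proof (rule f''_ge0_imp_convex[where f' = "\<lambda>c. - l * exp ((2 - c) * l) - l * exp (c * l)"
        and f'' = "\<lambda>c. l^2 * (exp ((2 - c) * l) - exp (c * l))"])
    show "convex {1..2::real}" by simp
    show "(f has_real_derivative - l * exp ((2 - c) * l) - l * exp (c * l)) (at c)" for c
      unfolding f_def by (auto intro!: derivative_eq_intros)
    show "((\<lambda>c. - l * exp ((2 - c) * l) - l * exp (c * l)) has_real_derivative
        l^2 * (exp ((2 - c) * l) - exp (c * l))) (at c)" for c
      by (auto intro!: derivative_eq_intros simp: power2_eq_square algebra_simps)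
    show "0 \<le> l^2 * (exp ((2 - c) * l) - exp (c * l))" if "c \<in> {1..2}" for c
      using that l by (intro mult_nonneg_nonneg) (auto intro: mult_right_mono_neg)
  qed
  from convex_onD[OF this, of "c - 1" 1 2]
  have "f c \<le> (1 - (c - 1)) * f 1 + (c - 1) * f 2" using assms by (simp add: algebra_simps)
  then show ?thesis
    using assms by (simp add: f_def powr_def l_def flip: powr_numeral)
qed

text \<open>Both sides equal 1 at \<open>a = 0\<close>. The logarithm \<open>N\<close> of the right-hand side divided by the
  left-hand side is nondecreasing on \<open>[0, 1)\<close>: its derivative at \<open>x\<close>, with \<open>b = x powr c\<close>, is bounded
  below by the expression obtained for \<open>s = 2\<close>, whose sign is that of the difference of the two sides in the preceding lemma.\<close>

lemma powr_exponent_tradeoff: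
  fixes a c r s :: real
  assumes a: "0 \<le> a" "a \<le> 1" and c: "1 \<le> c" "c \<le> 2" and s: "s = c * r" "2 \<le> s"
  shows "(1 - a powr c) * (1 + a powr c) powr (r - 1) \<le> (1 - a) * (1 + a) powr (s - 1)"
proof (cases "a = 1")
  case True then show ?thesis by simp
next
  case False
  with a have a1: "a < 1" by simp
  have ac: "x powr c < 1" if "0 \<le> x" "x < 1" for x
    using that c powr_less_mono2[of c x 1] by simp
  define N where "N = (\<lambda>x. ln (1 - x) + (s - 1) * ln (1 + x) - ln (1 - x powr c) - (r - 1) * ln (1 + x powr c))"
  have "N 0 \<le> N a"
  proof (rule DERIV_nonneg_imp_increasing_open[OF a(1)])
    show "continuous_on {0..a} N"
      unfolding N_def using a1 c ac
      by (intro continuous_intros continuous_on_powr') (force simp: add_nonneg_eq_0_iff)+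
    fix x assume x: "0 < x" "x < a"
    then have x1: "x < 1" using a1 by simp
    define b where "b = x powr c"
    have b: "0 < b" "b < 1" "b \<le> x"
      using x x1 ac[of x] powr_mono'[of 1 c x] c by (auto simp: b_def)
    let ?D = "- (1 / (1 - x)) + (s - 1) / (1 + x) + (c * (b / x)) / (1 - b) - (r - 1) * (c * (b / x)) / (1 + b)"
    have "x powr (c - 1) = b / x"
      using x by (simp add: b_def powr_diff)
    then have "(N has_real_derivative ?D) (at x)"
      unfolding N_def using x x1 b
      by (auto intro!: derivative_eq_intros simp: b_def[symmetric] mult_ac)
    moreover have "0 \<le> ?D"
    proof -
      have "x powr (2 - c) = x^2 / b"
        using x by (simp add: b_def powr_diff)
      then have "x^2 / b - b \<le> (c - 1) * (1 - x^2)"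
        using powr_diff_chord[of x c] x x1 c by (simp add: b_def)
      then have *: "x^2 - b^2 \<le> (c - 1) * b * (1 - x^2)"
        using b by (simp add: field_simps power2_eq_square)
      have p: "0 < 1 - x^2" "0 < 1 - b^2"
        using x x1 b by (simp_all add: abs_square_less_1)
      have f: "1 - x^2 = (1 - x) * (1 + x)" "1 - b^2 = (1 - b) * (1 + b)"
        by (auto simp: algebra_simps power2_eq_square)
      have nz: "1 - x \<noteq> 0" "1 + x \<noteq> 0" "1 - b \<noteq> 0" "1 + b \<noteq> 0" "x \<noteq> 0"
        using x x1 b by auto
      have "x * (- (1 / (1 - x)) + (s - 1) / (1 + x)) = - (2 * x / (1 - x^2)) + s * (x / (1 + x))"
        unfolding f using nz by (simp add: divide_simps) (simp add: algebra_simps)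
      moreover have "x * ((c * (b / x)) / (1 - b) - (r - 1) * (c * (b / x)) / (1 + b))
          = 2 * (c * b / (1 - b^2)) - s * (b / (1 + b))"
        unfolding f s using nz by (simp add: divide_simps) (simp add: algebra_simps)
      ultimately have "x * ?D = - (2 * x / (1 - x^2)) + 2 * (c * b / (1 - b^2)) + s * (x / (1 + x) - b / (1 + b))"
        by (simp only: ring_distribs)
      \<comment> \<open>Since \<open>c \<ge> 1\<close> gives \<open>b \<le> x\<close>, the coefficient of \<open>s\<close> is nonnegative and \<open>s\<close> may be replaced by 2.\<close>
      also have "\<dots> \<ge> - (2 * x / (1 - x^2)) + 2 * (c * b / (1 - b^2)) + 2 * (x / (1 + x) - b / (1 + b))"
      proof -
        have "b / (1 + b) \<le> x / (1 + x)"
          using b x by (simp add: pos_divide_le_eq pos_le_divide_eq algebra_simps)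
        then show ?thesis
          using s by (intro add_left_mono mult_right_mono) auto
      qed
      also have "- (2 * x / (1 - x^2)) + 2 * (c * b / (1 - b^2)) + 2 * (x / (1 + x) - b / (1 + b))
         = 2 * ((c - 1) * b * (1 - x^2) - (x^2 - b^2)) / ((1 - x^2) * (1 - b^2))"
        unfolding f using nz by (simp add: divide_simps) (simp add: algebra_simps power2_eq_square)
      finally have "0 \<le> x * ?D"
        using * p by (smt (verit) divide_nonneg_pos mult_pos_pos)
      then show ?thesis using x zero_le_mult_iff[of x ?D] by simp
    qed
    ultimately show "\<exists>y. (N has_real_derivative y) (at x) \<and> 0 \<le> y" by blast
  qed
  then have "ln (1 - a powr c) + (r - 1) * ln (1 + a powr c) \<le> ln (1 - a) + (s - 1) * ln (1 + a)"
    using c by (simp add: N_def)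
  then have "exp (ln (1 - a powr c) + (r - 1) * ln (1 + a powr c)) \<le> exp (ln (1 - a) + (s - 1) * ln (1 + a))"
    by simp
  then show ?thesis
    using a a1 ac[OF a(1) a1] add_pos_nonneg[of 1 "a powr c"] by (simp add: exp_add powr_def)
qed


text \<open>With \<open>a = t powr p\<close> and \<open>c = s / r\<close>, so that \<open>a powr c = t\<^sup>2\<close> and \<open>a powr (s / 2) = t powr r\<close>, the
  claim reads \<open>J a \<ge> 2\<close>, where \<open>J a = ((1 + a) powr s - (1 + a powr c) powr r) * a powr (- s / 2)\<close>.
  The preceding lemma says that \<open>J\<close> is nonincreasing on \<open>(0, 1]\<close>, and \<open>J 1 = 2 powr s - 2 powr r = 2\<close>;
  this last equality is where the definition of \<open>s\<close> enters.\<close>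

lemma two_add_powr_le:
  fixes r p s t :: real
  assumes r: "1 \<le> r" and s: "2 powr s = 2 + 2 powr r" "2 \<le> s" "r \<le> s" "s \<le> 2 * r"
    and p: "p = 2 * r / s" and t: "0 < t" "t \<le> 1"
  shows "2 * t powr r + (1 + t\<^sup>2) powr r \<le> (1 + t powr p) powr s"
proof -
  define c where "c = s / r"
  have c: "1 \<le> c" "c \<le> 2" "s = c * r" using r s by (auto simp: c_def field_simps)
  define J where "J = (\<lambda>x. ((1 + x) powr s - (1 + x powr c) powr r) * x powr (- s / 2))"
  define a where "a = t powr p"
  have p0: "0 < p" using r s p by simp
  have a: "0 < a" "a \<le> 1" using t p0 by (auto simp: a_def intro: powr_le1)
  have "J 1 \<le> J a"
  proof (rule DERIV_nonpos_imp_nonincreasing[OF a(2)], goal_cases)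
    case (1 x)
    then have x: "0 < x" "x \<le> 1" using a by auto
    define b where "b = x powr c"
    have b: "0 < b" using x by (simp add: b_def)
    have cb: "x powr (c - 1) = b / x" using x by (simp add: b_def powr_diff)
    let ?A = "(1 + x) powr (s - 1)" and ?B = "(1 + b) powr (r - 1)"
    have AB: "(1 + x) powr s = ?A * (1 + x)" "(1 + b) powr r = ?B * (1 + b)"
      using x b by (simp_all add: powr_diff)
    let ?D = "(s * ?A - r * ?B * (c * x powr (c - 1))) * x powr (- s / 2)
       + ((1 + x) powr s - (1 + b) powr r) * (- s / 2 * x powr (- s / 2 - 1))"
    have d1: "((\<lambda>x. (1 + x) powr s) has_real_derivative s * ?A) (at x)"
      using x by (auto intro!: derivative_eq_intros)
    have "((\<lambda>x. 1 + x powr c) has_real_derivative c * x powr (c - 1)) (at x)"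
      using x by (auto intro!: derivative_eq_intros)
    from DERIV_fun_powr[OF this, of r]
    have d2: "((\<lambda>x. (1 + x powr c) powr r) has_real_derivative r * ?B * (c * x powr (c - 1))) (at x)"
      using x b by (simp add: b_def add_pos_pos)
    have "(J has_real_derivative ?D) (at x)"
      unfolding J_def
      using DERIV_mult[OF DERIV_diff[OF d1 d2] has_real_derivative_powr[of x "- s / 2"]] x
      by (simp add: b_def algebra_simps)
    moreover have "?D = - (s / 2 * (?A * (1 - x) - ?B * (1 - b)) * x powr (- s / 2 - 1))"
    proof -
      have "x powr (- s / 2) = x * x powr (- s / 2 - 1)"
        using x by (simp add: powr_diff)
      then show ?thesis
        unfolding AB cb using x c(3) by (simp add: field_simps)
    qed
    moreover have "?B * (1 - b) \<le> ?A * (1 - x)"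
      using powr_exponent_tradeoff[of x c s r] x c s by (simp add: b_def mult.commute)
    ultimately show ?case using s by (smt (verit) mult_nonneg_nonneg powr_ge_zero divide_nonneg_nonneg)
  qed
  then have "2 \<le> J a" using s by (simp add: J_def)
  also have "J a = ((1 + a) powr s - (1 + a powr c) powr r) / a powr (s / 2)"
    using powr_minus_divide[of a "s / 2"] by (simp add: J_def)
  also have "a powr c = t\<^sup>2"
    using t p r s by (simp add: a_def powr_powr c_def flip: powr_numeral)
  also have "a powr (s / 2) = t powr r"
    using t p r s by (simp add: a_def powr_powr)
  finally show ?thesis using t by (simp add: a_def pos_le_divide_eq)
qed

lemma two_add_powr_le_reciprocal:
  fixes r p s t :: real
  assumes r: "1 \<le> r" and s: "2 powr s = 2 + 2 powr r" "2 \<le> s" "r \<le> s" "s \<le> 2 * r"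
    and p: "p = 2 * r / s" and t: "0 < t"
  shows "2 + (t + 1 / t) powr r \<le> (2 + (t powr p + t powr (- p))) powr (s / 2)"
proof -
  have *: "2 + (t + 1 / t) powr r \<le> (2 + (t powr p + t powr (- p))) powr (s / 2)"
    if t: "0 < t" "t \<le> 1" for t :: real
  proof -
    have e1: "t + 1 / t = (1 + t\<^sup>2) / t"
      using t by (simp add: field_simps power2_eq_square)
    have "2 + (t powr p + t powr (- p)) = (1 + t powr p)\<^sup>2 / t powr p"
      using t by (simp add: powr_minus field_simps power2_eq_square)
    also have "\<dots> powr (s / 2) = ((1 + t powr p)\<^sup>2) powr (s / 2) / t powr r"
      using t r s p by (simp add: powr_divide powr_powr)
    also have "((1 + t powr p)\<^sup>2) powr (s / 2) = (1 + t powr p) powr s"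
      using powr_powr[of "1 + t powr p" 2 "s / 2"] by (simp add: add_pos_nonneg)
    finally have e2: "(2 + (t powr p + t powr (- p))) powr (s / 2) = (1 + t powr p) powr s / t powr r" .
    have e3: "(t + 1 / t) powr r = (1 + t\<^sup>2) powr r / t powr r"
      unfolding e1 using t by (simp add: powr_divide)
    show ?thesis
      unfolding e2 e3 using two_add_powr_le[OF r s p t] t
        divide_right_mono[of "2 * t powr r + (1 + t\<^sup>2) powr r" "(1 + t powr p) powr s" "t powr r"]
      by (simp add: add_divide_distrib)
  qed
  show ?thesis
  proof (cases "t \<le> 1")
    case True
    then show ?thesis using * t by simp
  next
    case False
    have "(1 / t) powr p = t powr (- p)" "(1 / t) powr (- p) = t powr p"
      using t by (simp_all add: powr_divide powr_minus_divide)
    then show ?thesis using False *[of "1 / t"] t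
      by (simp add: add.commute)
  qed
qed

text \<open>The one-dimensional bilinear inequality. For positive entries, the four products
  \<open>a0 * b0\<close>, \<open>a1 * b1\<close>, \<open>a0 * b1\<close>, \<open>a1 * b0\<close> are written as \<open>g * z\<close>, \<open>g / z\<close>, \<open>g * x\<close>, \<open>g / x\<close>. The
  factor \<open>g\<close> cancels by homogeneity, and \<open>z\<close> and \<open>x\<close> are free: the case \<open>z = 1\<close> is
  \<open>two_add_powr_le_reciprocal\<close>, and \<open>powr_reciprocal_sum_le\<close> extends it to all \<open>z\<close>. If an entry
  vanishes, superadditivity of \<open>x powr (s / 2)\<close> is enough.\<close>

lemma two_point_inequality:
  fixes r p s a0 a1 b0 b1 :: real
  assumes r: "1 \<le> r" and s: "2 powr s = 2 + 2 powr r" "2 \<le> s" "r \<le> s" "s \<le> 2 * r"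
    and p: "p = 2 * r / s" and nn: "0 \<le> a0" "0 \<le> a1" "0 \<le> b0" "0 \<le> b1"
  shows "(a0 * b0) powr r + (a0 * b1 + a1 * b0) powr r + (a1 * b1) powr r
     \<le> ((a0 powr p + a1 powr p) * (b0 powr p + b1 powr p)) powr (s / 2)"
proof -
  have p0: "0 < p" and pk: "p * (s / 2) = r" using r s p by auto
  have pp: "(x powr p) powr (s / 2) = x powr r" for x :: real
    by (simp only: powr_powr pk)
  have sup: "x powr r + y powr r \<le> (x powr p + y powr p) powr (s / 2)" for x y :: real
    using powr_superadditive[of "s / 2" "x powr p" "y powr p"] s by (simp add: pp del: powr_powr)
  consider "a0 = 0" | "a1 = 0" | "b0 = 0" | "b1 = 0" | "0 < a0" "0 < a1" "0 < b0" "0 < b1"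
    using nn by linarith
  then show ?thesis
  proof cases
    case 1
    then show ?thesis using sup[of b0 b1] nn
      by (simp add: powr_mult pp mult_left_mono flip: distrib_left del: powr_powr)
  next
    case 2
    then show ?thesis using sup[of b0 b1] nn
      by (simp add: powr_mult pp mult_left_mono flip: distrib_left del: powr_powr)
  next
    case 3
    then show ?thesis using sup[of a0 a1] nn
      by (simp add: powr_mult pp mult_right_mono flip: distrib_right del: powr_powr)
  next
    case 4
    then show ?thesis using sup[of a0 a1] nn
      by (simp add: powr_mult pp mult_right_mono flip: distrib_right del: powr_powr)
  next
    case 5
    define g z x where "g = sqrt (a0 * b0 * (a1 * b1))" and "z = a0 * b0 / g" and "x = a0 * b1 / g"
    have g: "0 < g" "g * g = a0 * b0 * (a1 * b1)" using 5 by (simp_all add: g_def)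
    have z: "0 < z" and x: "0 < x" using 5 g by (simp_all add: z_def x_def)
    have e: "a0 * b0 = g * z" "a1 * b1 = g * (1 / z)" "a0 * b1 = g * x" "a1 * b0 = g * (1 / x)"
      using 5 g by (simp_all add: z_def x_def field_simps)
    define L where "L = x powr p + x powr (- p)"
    have L: "2 \<le> L"
    proof -
      have "2 * 1 \<le> u + 1 / u" if "0 < u" for u :: real
        using that sum_squares_bound[of 1 u] by (simp add: field_simps power2_eq_square)
      from this[of "x powr p"] show ?thesis using x by (simp add: L_def powr_minus divide_inverse)
    qed
    have "(z powr p) powr (s / 2) + (z powr p) powr (- (s / 2)) + (x + 1 / x) powr r
        \<le> (z powr p + 1 / z powr p + L) powr (s / 2)"
      using s z L two_add_powr_le_reciprocal[OF r s p x]
      by (intro powr_reciprocal_sum_le) (auto simp: L_def)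
    moreover have "(z powr p) powr (- (s / 2)) = (1 / z) powr r"
      using z by (simp only: powr_minus_divide pp) (simp add: powr_divide)
    moreover have "1 / z powr p = (1 / z) powr p" "x powr (- p) = (1 / x) powr p"
      using z x by (simp_all add: powr_divide powr_minus_divide)
    ultimately have main: "z powr r + (1 / z) powr r + (x + 1 / x) powr r
        \<le> (z powr p + (1 / z) powr p + (x powr p + (1 / x) powr p)) powr (s / 2)"
      by (simp only: pp L_def)
    have "(a0 * b0) powr r + (a0 * b1 + a1 * b0) powr r + (a1 * b1) powr r
        = g powr r * (z powr r + (1 / z) powr r + (x + 1 / x) powr r)"
      unfolding e distrib_left[symmetric] powr_mult by (simp add: distrib_left)
    also have "\<dots> \<le> g powr r * (z powr p + (1 / z) powr p + (x powr p + (1 / x) powr p)) powr (s / 2)"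
      by (intro mult_left_mono main) simp
    also have "\<dots> = ((g * z) powr p + (g * (1 / z)) powr p + ((g * x) powr p + (g * (1 / x)) powr p)) powr (s / 2)"
      by (simp only: powr_mult pp distrib_left[symmetric])
    also have "\<dots> = ((a0 powr p + a1 powr p) * (b0 powr p + b1 powr p)) powr (s / 2)"
      unfolding e[symmetric] by (simp add: powr_mult algebra_simps)
    finally show ?thesis .
  qed
qed

section \<open>Tensorization\<close>

lemma powr_convex_combination:
  fixes r l m x y :: real
  assumes r: "1 \<le> r" and lm: "0 \<le> l" "0 \<le> m" "l + m = 1" and xy: "0 \<le> x" "0 \<le> y"
  shows "(l * x + m * y) powr r \<le> l * x powr r + m * y powr r"
proof (cases "l * x + m * y = 0")
  case True
  then show ?thesis using lm by simp
next
  case False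
  define w where "w = l * x + m * y"
  have w: "0 < w" using False lm xy by (simp add: w_def order_less_le)
  have "1 = l * (1 + r * (x / w - 1)) + m * (1 + r * (y / w - 1))"
  proof -
    have "l * (x / w) + m * (y / w) = 1"
      using w by (simp add: w_def flip: add_divide_distrib)
    moreover have "l * (1 + r * (x / w - 1)) + m * (1 + r * (y / w - 1))
        = (l + m) + r * ((l * (x / w) + m * (y / w)) - (l + m))"
      by (simp add: algebra_simps)
    ultimately show ?thesis using lm by simp
  qed
  also have "\<dots> \<le> l * (x / w) powr r + m * (y / w) powr r"
    using r lm xy w by (intro add_mono mult_left_mono powr_bernoulli) auto
  also have "\<dots> = (l * x powr r + m * y powr r) / w powr r"
    by (simp add: powr_divide add_divide_distrib)
  finally show ?thesis using w by (simp add: w_def[symmetric] pos_le_divide_eq)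
qed

text \<open>Minkowski's inequality for the \<open>\<ell>\<^sup>r\<close> norm, stated with upper bounds \<open>a\<close> and \<open>b\<close> for the two norms.\<close>

lemma sum_powr_add_le:
  fixes u v :: "'a \<Rightarrow> real"
  assumes r: "1 \<le> r" and uv: "\<And>x. 0 \<le> u x" "\<And>x. 0 \<le> v x" and ab: "0 \<le> a" "0 \<le> b"
    and u: "(\<Sum>x\<in>C. u x powr r) \<le> a powr r" and v: "(\<Sum>x\<in>C. v x powr r) \<le> b powr r"
    and C: "finite C"
  shows "(\<Sum>x\<in>C. (u x + v x) powr r) \<le> (a + b) powr r"
proof -
  have zero: "\<forall>x\<in>C. h x = 0" if "(\<Sum>x\<in>C. h x powr r) \<le> 0 powr r" for h :: "'a \<Rightarrow> real"
    using that C sum_nonneg_eq_0_iff[of C "\<lambda>x. h x powr r"] by (auto simp: sum_nonneg antisym)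
  consider "a = 0" | "b = 0" | "0 < a" "0 < b" using ab by linarith
  then show ?thesis
  proof cases
    case 1
    with zero[of u] u have "(\<Sum>x\<in>C. (u x + v x) powr r) = (\<Sum>x\<in>C. v x powr r)"
      by (intro sum.cong) auto
    then show ?thesis using 1 v by simp
  next
    case 2
    with zero[of v] v have "(\<Sum>x\<in>C. (u x + v x) powr r) = (\<Sum>x\<in>C. u x powr r)"
      by (intro sum.cong) auto
    then show ?thesis using 2 u by simp
  next
    case 3
    define w where "w = a + b"
    have w: "0 < w" using 3 by (simp add: w_def)
    have "(u x + v x) powr r \<le> w powr r * (a / w * (u x powr r / a powr r) + b / w * (v x powr r / b powr r))" for x
    proof -
      have "(a / w * (u x / a) + b / w * (v x / b)) powr r \<le> a / w * (u x / a) powr r + b / w * (v x / b) powr r"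
        using r 3 w uv by (intro powr_convex_combination) (auto simp: w_def add_divide_distrib[symmetric])
      also have "a / w * (u x / a) + b / w * (v x / b) = (u x + v x) / w"
        using 3 by (simp add: add_divide_distrib)
      finally show ?thesis using w by (simp add: powr_divide pos_divide_le_eq mult.commute)
    qed
    then have "(\<Sum>x\<in>C. (u x + v x) powr r)
        \<le> (\<Sum>x\<in>C. w powr r * (a / w * (u x powr r / a powr r) + b / w * (v x powr r / b powr r)))"
      by (intro sum_mono)
    also have "\<dots> = w powr r * (a / w * ((\<Sum>x\<in>C. u x powr r) / a powr r) + b / w * ((\<Sum>x\<in>C. v x powr r) / b powr r))"
      by (simp only: sum.distrib[symmetric] sum_distrib_left sum_divide_distrib)
    also have "\<dots> \<le> w powr r * (a / w * 1 + b / w * 1)"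
      using 3 w u v by (intro mult_left_mono add_mono) (auto simp: pos_divide_le_eq)
    also have "\<dots> = w powr r" using w by (simp add: w_def add_divide_distrib[symmetric])
    finally show ?thesis by (simp add: w_def)
  qed
qed

text \<open>Convolution of the restrictions of \<open>f\<close> and \<open>g\<close> to \<open>A\<close>, as a finite double sum when \<open>A\<close> is
  finite; values of \<open>f\<close> and \<open>g\<close> outside \<open>A\<close> play no role.\<close>

definition conv_on :: "'a::ab_group_add set \<Rightarrow> ('a \<Rightarrow> real) \<Rightarrow> ('a \<Rightarrow> real) \<Rightarrow> 'a \<Rightarrow> real" where
  "conv_on A f g z = (\<Sum>x\<in>A. \<Sum>y\<in>A. if x + y = z then f x * g y else 0)"

lemma conv_on_nonneg: "(\<And>x. 0 \<le> f x) \<Longrightarrow> (\<And>x. 0 \<le> g x) \<Longrightarrow> 0 \<le> conv_on A f g z"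
  by (auto simp: conv_on_def intro!: sum_nonneg)

lemma conv_on_eq_0:
  assumes "\<And>x y. x \<in> A \<Longrightarrow> y \<in> A \<Longrightarrow> x + y \<in> C" "z \<notin> C"
  shows "conv_on A f g z = 0"
  unfolding conv_on_def using assms by (intro sum.neutral ballI) auto

lemma conv_on_shift_union:
  fixes A :: "'a::ab_group_add set"
  assumes "finite A" "A \<inter> (+) e ` A = {}"
  shows "conv_on (A \<union> (+) e ` A) f g z =
    conv_on A f g z + (conv_on A f (\<lambda>x. g (e + x)) (z - e) + conv_on A (\<lambda>x. f (e + x)) g (z - e))
    + conv_on A (\<lambda>x. f (e + x)) (\<lambda>x. g (e + x)) (z - e - e)"
proof -
  have split: "(\<Sum>x\<in>A \<union> (+) e ` A. h x) = (\<Sum>x\<in>A. h x) + (\<Sum>x\<in>A. h (e + x))" for h :: "'a \<Rightarrow> real"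
    using assms by (simp add: sum.union_disjoint sum.reindex)
  have "(x + (e + y) = z) = (x + y = z - e)" "(e + x + y = z) = (x + y = z - e)"
    "(e + x + (e + y) = z) = (x + y = z - e - e)" for x y
    by (auto simp: algebra_simps)
  then show ?thesis
    unfolding conv_on_def split by (simp add: sum.distrib)
qed

text \<open>The induction step on the dimension. A function on \<open>A \<union> (e + A)\<close> is a pair of functions on \<open>A\<close>,
  and the convolution of two of them splits over \<open>C\<close>, \<open>e + C\<close> and \<open>e + e + C\<close>. The bound on \<open>A\<close> and
  Minkowski's inequality reduce the claim to the two-point inequality for the norms of the slices.\<close>

lemma convolution_bound_shift_union:
  fixes A C :: "'a::ab_group_add set" and r p k :: real
  assumes r: "1 \<le> r" and p: "0 < p" "p * k = r"
    and two_point: "\<And>a0 a1 b0 b1. 0 \<le> a0 \<Longrightarrow> 0 \<le> a1 \<Longrightarrow> 0 \<le> b0 \<Longrightarrow> 0 \<le> b1 \<Longrightarrow>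
      (a0 * b0) powr r + (a0 * b1 + a1 * b0) powr r + (a1 * b1) powr r
        \<le> ((a0 powr p + a1 powr p) * (b0 powr p + b1 powr p)) powr k"
    and fin: "finite A" "finite C" and A: "A \<inter> (+) e ` A = {}"
    and AC: "\<And>x y. x \<in> A \<Longrightarrow> y \<in> A \<Longrightarrow> x + y \<in> C"
    and C: "\<And>w. w \<in> C \<Longrightarrow> e + w \<notin> C" "\<And>w. w \<in> C \<Longrightarrow> e + e + w \<notin> C"
    and IH: "\<And>f g. (\<And>x. 0 \<le> f x) \<Longrightarrow> (\<And>x. 0 \<le> g x) \<Longrightarrow>
      (\<Sum>z\<in>C. conv_on A f g z powr r) \<le> ((\<Sum>x\<in>A. f x powr p) * (\<Sum>x\<in>A. g x powr p)) powr k"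
    and f: "\<And>x. 0 \<le> f x" and g: "\<And>x. 0 \<le> g x"
  shows "(\<Sum>z\<in>C \<union> (+) e ` C \<union> (+) (e + e) ` C. conv_on (A \<union> (+) e ` A) f g z powr r)
    \<le> ((\<Sum>x\<in>A \<union> (+) e ` A. f x powr p) * (\<Sum>x\<in>A \<union> (+) e ` A. g x powr p)) powr k"
proof -
  define f' g' where "f' = (\<lambda>x. f (e + x))" and "g' = (\<lambda>x. g (e + x))"
  have f': "0 \<le> f' x" and g': "0 \<le> g' x" for x using f g by (auto simp: f'_def g'_def)
  define N where "N = (\<lambda>h :: 'a \<Rightarrow> real. (\<Sum>x\<in>A. h x powr p) powr (1 / p))"
  have N: "0 \<le> N h" "N h powr p = (\<Sum>x\<in>A. h x powr p)" for h
    using p by (simp_all add: N_def powr_powr sum_nonneg)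
  have IH': "(\<Sum>z\<in>C. conv_on A f g z powr r) \<le> (N f * N g) powr r"
    if "\<And>x. 0 \<le> f x" "\<And>x. 0 \<le> g x" for f g
  proof -
    have "((\<Sum>x\<in>A. f x powr p) * (\<Sum>x\<in>A. g x powr p)) powr k = ((N f * N g) powr p) powr k"
      by (simp only: N powr_mult)
    also have "\<dots> = (N f * N g) powr r" by (simp only: powr_powr p)
    finally show ?thesis using IH[of f g, OF that] by simp
  qed
  let ?c = "conv_on (A \<union> (+) e ` A) f g"
  note c = conv_on_shift_union[OF fin(1) A, of f g, folded f'_def g'_def]
  note z = conv_on_eq_0[of A C, OF AC]
  have C': "w - e \<notin> C" "w - e - e \<notin> C" if "w \<in> C" for w
    using C(1)[of "w - e"] C(2)[of "w - e - e"] that by (auto simp: algebra_simps)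
  have c0: "?c w = conv_on A f g w" if "w \<in> C" for w
    using that C' by (simp add: c z)
  have c1: "?c (e + w) = conv_on A f g' w + conv_on A f' g w" if "w \<in> C" for w
    using that C(1) C'(1) by (simp add: c z)
  have c2: "?c (e + e + w) = conv_on A f' g' w" if "w \<in> C" for w
  proof -
    have "e + e + w - e = e + w" "e + w - e = w" by (auto simp: algebra_simps)
    then show ?thesis using that C by (simp add: c z)
  qed
  have inj: "inj_on ((+) d) C" for d by simp
  have disj: "C \<inter> (+) e ` C = {}" "(C \<union> (+) e ` C) \<inter> (+) (e + e) ` C = {}"
    using C by (auto simp: add.assoc)
  have "(\<Sum>z\<in>C \<union> (+) e ` C \<union> (+) (e + e) ` C. ?c z powr r)
     = (\<Sum>w\<in>C. ?c w powr r) + (\<Sum>w\<in>C. ?c (e + w) powr r) + (\<Sum>w\<in>C. ?c (e + e + w) powr r)"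
    using fin disj by (simp add: sum.union_disjoint sum.reindex)
  also have "\<dots> = (\<Sum>w\<in>C. conv_on A f g w powr r) + (\<Sum>w\<in>C. (conv_on A f g' w + conv_on A f' g w) powr r)
      + (\<Sum>w\<in>C. conv_on A f' g' w powr r)"
    by (simp add: c0 c1 c2)
  also have "\<dots> \<le> (N f * N g) powr r + (N f * N g' + N f' * N g) powr r + (N f' * N g') powr r"
    using f g f' g' r N fin by (intro add_mono IH' sum_powr_add_le conv_on_nonneg) auto
  also have "\<dots> \<le> ((N f powr p + N f' powr p) * (N g powr p + N g' powr p)) powr k"
    by (intro two_point N)
  also have "N f powr p + N f' powr p = (\<Sum>x\<in>A \<union> (+) e ` A. f x powr p)"
    using fin A by (simp add: N f'_def sum.union_disjoint sum.reindex)
  also have "N g powr p + N g' powr p = (\<Sum>x\<in>A \<union> (+) e ` A. g x powr p)"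
    using fin A by (simp add: N g'_def sum.union_disjoint sum.reindex)
  finally show ?thesis .
qed

section \<open>Lattice cubes\<close>

text \<open>The cube \<open>{0..m}\<close> in the coordinates of \<open>I\<close>, embedded in the full lattice by zeros in the other
  coordinates. Induction on the dimension thus becomes induction on the set \<open>I\<close>.\<close>

definition grid :: "'d set \<Rightarrow> int \<Rightarrow> (int ^ 'd) set" where
  "grid I m = {x. (\<forall>i\<in>I. 0 \<le> x $ i \<and> x $ i \<le> m) \<and> (\<forall>i. i \<notin> I \<longrightarrow> x $ i = 0)}"

lemma grid_empty: "grid {} m = {0}"
  by (auto simp: grid_def vec_eq_iff)

lemma grid_insert:
  fixes I :: "'d::finite set"
  assumes "i \<notin> I"
  shows "grid (insert i I) m = (\<Union>j\<in>{0..m}. (+) (axis i j) ` grid I m)"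
proof (intro set_eqI iffI)
  fix x assume x: "x \<in> grid (insert i I) m"
  have "x - axis i (x $ i) \<in> grid I m"
    using x assms by (auto simp: grid_def axis_def)
  then have "x \<in> (+) (axis i (x $ i)) ` grid I m"
    by (rule rev_image_eqI) simp
  moreover have "x $ i \<in> {0..m}" using x by (auto simp: grid_def)
  ultimately show "x \<in> (\<Union>j\<in>{0..m}. (+) (axis i j) ` grid I m)" by blast
next
  fix x assume "x \<in> (\<Union>j\<in>{0..m}. (+) (axis i j) ` grid I m)"
  then show "x \<in> grid (insert i I) m"
    using assms by (auto simp: grid_def axis_def)
qed

lemma finite_grid:
  fixes I :: "'d::finite set"
  shows "finite (grid I m)"
  using finite[of I] by induction (auto simp: grid_empty grid_insert)

lemma grid_add: "x \<in> grid I m \<Longrightarrow> y \<in> grid I n \<Longrightarrow> x + y \<in> grid I (m + n)"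
  by (auto simp: grid_def intro: add_mono)

lemma convolution_bound_grid:
  fixes I :: "'d::finite set" and f g :: "int ^ 'd \<Rightarrow> real" and r p k :: real
  assumes r: "1 \<le> r" and p: "0 < p" "p * k = r"
    and two_point: "\<And>a0 a1 b0 b1. 0 \<le> a0 \<Longrightarrow> 0 \<le> a1 \<Longrightarrow> 0 \<le> b0 \<Longrightarrow> 0 \<le> b1 \<Longrightarrow>
      (a0 * b0) powr r + (a0 * b1 + a1 * b0) powr r + (a1 * b1) powr r
        \<le> ((a0 powr p + a1 powr p) * (b0 powr p + b1 powr p)) powr k"
    and "\<And>x. 0 \<le> f x" "\<And>x. 0 \<le> g x"
  shows "(\<Sum>z\<in>grid I 2. conv_on (grid I 1) f g z powr r)
    \<le> ((\<Sum>x\<in>grid I 1. f x powr p) * (\<Sum>x\<in>grid I 1. g x powr p)) powr k"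
  using finite[of I] assms(5,6)
proof (induction arbitrary: f g)
  case empty
  then show ?case
    by (simp add: grid_empty conv_on_def powr_mult[symmetric] powr_powr p)
next
  case (insert i I)
  define e :: "int ^ 'd" where "e = axis i 1"
  have "{0..1::int} = {0, 1}" "{0..2::int} = {0, 1, 2}" by auto
  note iv = this
  have ax: "axis i 2 = e + e" "axis i 0 = (0 :: int ^ 'd)" "axis i 1 = e"
    by (auto simp: e_def axis_def vec_eq_iff)
  have g: "grid (insert i I) 1 = grid I 1 \<union> (+) e ` grid I 1"
    "grid (insert i I) 2 = grid I 2 \<union> (+) e ` grid I 2 \<union> (+) (e + e) ` grid I 2"
    unfolding grid_insert[OF insert(2)] iv UN_insert UN_empty ax by (simp_all add: Un_assoc)
  have ei: "e $ i = 1" by (simp add: e_def)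
  have zi: "x $ i = 0" if "x \<in> grid I m" for x m using that insert by (auto simp: grid_def)
  show ?case
    unfolding g
  proof (rule convolution_bound_shift_union[OF r p two_point finite_grid finite_grid])
    show "grid I 1 \<inter> (+) e ` grid I 1 = {}"
    proof -
      have "e + x \<notin> grid I 1" if "x \<in> grid I 1" for x
        using zi[OF that] zi[of "e + x" 1] ei by auto
      then show ?thesis by auto
    qed
    show "x + y \<in> grid I 2" if "x \<in> grid I 1" "y \<in> grid I 1" for x y
      using grid_add[OF that] by simp
    show "e + w \<notin> grid I 2" "e + e + w \<notin> grid I 2" if "w \<in> grid I 2" for w
      using zi[OF that] zi[of "e + w" 2] zi[of "e + e + w" 2] ei by auto
  qed (use insert in auto)
qed

lemma unit_cube_eq_grid: "(unit_cube :: (int ^ 'd::finite) set) = grid UNIV 1"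
proof -
  have "(v \<in> {0, 1}) = (0 \<le> v \<and> v \<le> 1)" for v :: int by auto
  then show ?thesis by (simp add: unit_cube_def grid_def)
qed

section \<open>Norms and convolutions of finitely supported functions\<close>

lemma lp_norm_finite_support:
  assumes "finite S" "supported_in f S"
  shows "lp_norm (ereal p) f = ereal ((\<Sum>x\<in>S. \<bar>f x\<bar> powr p) powr (1 / p))"
proof -
  have "((\<lambda>x. \<bar>f x\<bar> powr p) has_sum (\<Sum>x\<in>S. \<bar>f x\<bar> powr p)) UNIV"
    using assms by (intro has_sum_finite_neutralI) (auto simp: supported_in_def)
  then show ?thesis
    by (auto simp: lp_norm_def summable_on_def infsumI)
qed

lemma convolution_le_conv_on:
  assumes S: "finite S" and f: "supported_in f S" and g: "supported_in g S"
  shows "\<bar>convolution f g z\<bar> \<le> conv_on S (\<lambda>x. \<bar>f x\<bar>) (\<lambda>x. \<bar>g x\<bar>) z"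
proof -
  have "((\<lambda>y. f y * g (z - y)) has_sum (\<Sum>y\<in>S. f y * g (z - y))) UNIV"
    using S f by (intro has_sum_finite_neutralI) (auto simp: supported_in_def)
  then have "convolution f g z = (\<Sum>y\<in>S. f y * g (z - y))"
    by (simp add: convolution_def infsumI)
  also have "\<bar>\<dots>\<bar> \<le> (\<Sum>y\<in>S. \<bar>f y\<bar> * \<bar>g (z - y)\<bar>)"
    by (rule order_trans[OF sum_abs]) (simp add: abs_mult)
  also have "\<dots> = conv_on S (\<lambda>x. \<bar>f x\<bar>) (\<lambda>x. \<bar>g x\<bar>) z"
    unfolding conv_on_def
  proof (intro sum.cong refl)
    fix x assume "x \<in> S"
    have "(\<Sum>y\<in>S. if x + y = z then \<bar>f x\<bar> * \<bar>g y\<bar> else 0) = (\<Sum>y\<in>S. if y = z - x then \<bar>f x\<bar> * \<bar>g y\<bar> else 0)"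
      by (intro sum.cong) (auto simp: algebra_simps)
    also have "\<dots> = \<bar>f x\<bar> * \<bar>g (z - x)\<bar>"
      using S g by (simp add: sum.delta supported_in_def)
    finally show "\<bar>f x\<bar> * \<bar>g (z - x)\<bar> = (\<Sum>y\<in>S. if x + y = z then \<bar>f x\<bar> * \<bar>g y\<bar> else 0)" ..
  qed
  finally show ?thesis .
qed

text \<open>Log-convexity of \<open>\<ell>\<^sup>p\<close> norms in \<open>1 / p\<close>, at the midpoint: after normalisation by \<open>P\<close> and \<open>Q\<close> it is the
  weighted arithmetic-geometric mean inequality with weights \<open>t / (2 * p)\<close> and \<open>t / (2 * q)\<close>.\<close>

lemma sum_powr_interpolation:
  fixes h :: "'a \<Rightarrow> real"
  assumes S: "finite S" and h: "\<And>x. 0 \<le> h x" and pq: "0 < p" "0 < q" "0 < t" "1 / p + 1 / q = 2 / t"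
  shows "(\<Sum>x\<in>S. h x powr t) powr (2 / t) \<le> (\<Sum>x\<in>S. h x powr p) powr (1 / p) * (\<Sum>x\<in>S. h x powr q) powr (1 / q)"
proof (cases "\<forall>x\<in>S. h x = 0")
  case True
  then show ?thesis by simp
next
  case False
  then obtain x0 where x0: "x0 \<in> S" "0 < h x0" using h by (metis order_less_le)
  define P Q where "P = (\<Sum>x\<in>S. h x powr p)" and "Q = (\<Sum>x\<in>S. h x powr q)"
  have PQ: "0 < P" "0 < Q"
    unfolding P_def Q_def using S x0 by (auto intro!: sum_pos2[of S x0])
  define l m where "l = t / (2 * p)" and "m = t / (2 * q)"
  have lm: "0 \<le> l" "0 \<le> m" "l + m = 1"
  proof -
    have "l + m = t / 2 * (1 / p + 1 / q)" by (simp add: l_def m_def distrib_left)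
    then show "l + m = 1" using pq by simp
  qed (use pq in \<open>auto simp: l_def m_def\<close>)
  have e: "p * l = t / 2" "q * m = t / 2" using pq by (auto simp: l_def m_def)
  have "h x powr t / (P powr l * Q powr m) \<le> l * (h x powr p / P) + m * (h x powr q / Q)" for x
  proof (cases "h x = 0")
    case True
    then show ?thesis by simp
  next
    case False
    then have hx: "0 < h x" using h[of x] by simp
    have "(h x powr p / P) powr l * (h x powr q / Q) powr m \<le> l * (h x powr p / P) + m * (h x powr q / Q)"
      using lm PQ hx by (intro Youngs_inequality_0) auto
    moreover have "(h x powr p) powr l * (h x powr q) powr m = h x powr t"
      by (simp add: powr_powr e powr_add[symmetric])
    ultimately show ?thesis by (simp add: powr_divide del: powr_powr)
  qed
  then have "(\<Sum>x\<in>S. h x powr t / (P powr l * Q powr m)) \<le> (\<Sum>x\<in>S. l * (h x powr p / P) + m * (h x powr q / Q))"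
    by (intro sum_mono)
  also have "\<dots> = l * (P / P) + m * (Q / Q)"
    unfolding P_def Q_def by (simp only: sum.distrib sum_distrib_left sum_divide_distrib)
  also have "\<dots> = 1" using PQ lm by simp
  finally have "(\<Sum>x\<in>S. h x powr t) \<le> P powr l * Q powr m"
    using PQ by (simp add: sum_divide_distrib[symmetric] pos_divide_le_eq)
  then have "(\<Sum>x\<in>S. h x powr t) powr (2 / t) \<le> (P powr l * Q powr m) powr (2 / t)"
    using pq by (intro powr_mono2) (auto intro: sum_nonneg)
  also have "\<dots> = P powr (1 / p) * Q powr (1 / q)"
    using pq by (simp add: powr_mult powr_powr l_def m_def)
  finally show ?thesis by (simp add: P_def Q_def)
qed

text \<open>The same with \<open>p = \<infinity>\<close>; then \<open>t = 2 * q\<close>.\<close>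

lemma sum_powr_interpolation_sup:
  fixes h :: "'a \<Rightarrow> real"
  assumes h: "\<And>x. 0 \<le> h x" and M: "\<And>x. x \<in> S \<Longrightarrow> h x \<le> M" "0 \<le> M" and q: "0 < q" "0 < t" "1 / q = 2 / t"
  shows "(\<Sum>x\<in>S. h x powr t) powr (2 / t) \<le> M * (\<Sum>x\<in>S. h x powr q) powr (1 / q)"
proof -
  have t: "t = q + q" using q by (simp add: field_simps)
  have "(\<Sum>x\<in>S. h x powr t) \<le> (\<Sum>x\<in>S. M powr q * h x powr q)"
    unfolding t powr_add using M h q by (intro sum_mono mult_right_mono powr_mono2) auto
  also have "\<dots> = M powr q * (\<Sum>x\<in>S. h x powr q)" by (simp add: sum_distrib_left)
  finally have "(\<Sum>x\<in>S. h x powr t) powr (2 / t) \<le> (M powr q * (\<Sum>x\<in>S. h x powr q)) powr (1 / q)"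
    unfolding q(3)[symmetric] using q by (intro powr_mono2) (auto intro: sum_nonneg)
  also have "\<dots> = M * (\<Sum>x\<in>S. h x powr q) powr (1 / q)"
    using q(1) M by (simp add: powr_mult powr_powr)
  finally show ?thesis .
qed

lemma lp_norm_infinity_ge:
  "ereal \<bar>f x\<bar> \<le> lp_norm \<infinity> f"
  unfolding lp_norm_def by (simp only: if_True simp_thms) (rule SUP_upper, simp)

lemma lp_norm_infinity_interpolation:
  assumes S: "finite S" "supported_in f S" and t: "0 < t" "1 / q = 2 / t" "0 < q"
  shows "ereal ((\<Sum>x\<in>S. \<bar>f x\<bar> powr t) powr (2 / t)) \<le> lp_norm \<infinity> f * lp_norm (ereal q) f"
proof (cases "S = {}")
  case True
  then show ?thesis by (simp add: lp_norm_finite_support[OF S] flip: zero_ereal_def)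
next
  case False
  define M where "M = Max ((\<lambda>x. \<bar>f x\<bar>) ` S)"
  have "M \<in> (\<lambda>x. \<bar>f x\<bar>) ` S" unfolding M_def using S False by (intro Max_in) auto
  then obtain x where x: "M = \<bar>f x\<bar>" by auto
  have le: "\<bar>f y\<bar> \<le> M" if "y \<in> S" for y using that S by (auto simp: M_def)
  let ?Q = "(\<Sum>x\<in>S. \<bar>f x\<bar> powr q) powr (1 / q)"
  have "ereal ((\<Sum>x\<in>S. \<bar>f x\<bar> powr t) powr (2 / t)) \<le> ereal (M * ?Q)"
    using le x t by (subst ereal_less_eq) (intro sum_powr_interpolation_sup, auto)
  also have "\<dots> = ereal M * ereal ?Q" by simp
  also have "\<dots> \<le> lp_norm \<infinity> f * ereal ?Q"
    using lp_norm_infinity_ge[of f x] x by (intro ereal_mult_right_mono) auto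
  finally show ?thesis by (simp add: lp_norm_finite_support[OF S])
qed

lemma lp_norm_interpolation:
  fixes p q :: ereal
  assumes S: "finite S" "supported_in f S" and t: "0 < t" and pq: "1 \<le> p" "1 \<le> q" "1 / p + 1 / q = ereal (2 / t)"
  shows "ereal ((\<Sum>x\<in>S. \<bar>f x\<bar> powr t) powr (2 / t)) \<le> lp_norm p f * lp_norm q f"
proof -
  consider (fin) p' q' where "p = ereal p'" "q = ereal q'" | (pinf) q' where "p = \<infinity>" "q = ereal q'"
    | (qinf) p' where "p = ereal p'" "q = \<infinity>" | (inf) "p = \<infinity>" "q = \<infinity>"
    using pq by (cases p; cases q) auto
  then show ?thesis
  proof cases
    case fin
    then have p': "0 < p'" "0 < q'" "1 / p' + 1 / q' = 2 / t"
      using pq by (auto simp: one_ereal_def)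
    show ?thesis
      using sum_powr_interpolation[OF S(1), of "\<lambda>x. \<bar>f x\<bar>" p' q' t] p' t fin
      by (simp add: lp_norm_finite_support[OF S])
  next
    case pinf
    then have "0 < q'" "1 / q' = 2 / t" using pq by (auto simp: one_ereal_def)
    then show ?thesis using lp_norm_infinity_interpolation[OF S t] pinf by simp
  next
    case qinf
    then have "0 < p'" "1 / p' = 2 / t" using pq by (auto simp: one_ereal_def)
    then show ?thesis using lp_norm_infinity_interpolation[OF S t] qinf by (simp add: mult.commute)
  next
    case inf
    then show ?thesis using pq t by simp
  qed
qed

theorem corollary1p2:
  fixes f :: "int ^ 'd \<Rightarrow> real" and r :: real and p q :: ereal
  assumes "1 \<le> r"
    and "1 \<le> p" and "1 \<le> q"
    and "1 / p + 1 / q = ereal (log 2 (2 + 2 powr r) / r)"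
    and "supported_in f unit_cube"
  shows "lp_norm (ereal r) (convolution f f) \<le> lp_norm p f * lp_norm q f"
proof -
  define s where "s = log 2 (2 + 2 powr r)"
  define t where "t = 2 * r / s"
  have r2: "2 \<le> 2 powr r" using assms(1) powr_mono[of 1 r "2::real"] by simp
  have s: "2 powr s = 2 + 2 powr r" by (simp add: s_def add_pos_pos)
  have "2 powr 2 \<le> 2 powr s" using r2 by (simp add: s)
  then have s2: "2 \<le> s" by (subst (asm) powr_le_cancel_iff) auto
  have "2 powr r \<le> 2 powr s" by (simp add: s)
  then have rs: "r \<le> s" by simp
  have "2 + y \<le> y * y" if "2 \<le> y" for y :: real
    using mult_right_mono[of 2 y y] that by linarith
  \<comment> \<open>Here \<open>y = 2 powr r\<close>, so that \<open>s \<le> 2 * r\<close>.\<close>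
  from this[OF r2] have "2 powr s \<le> 2 powr (2 * r)"
    by (simp only: s mult_2 powr_add)
  then have sr: "s \<le> 2 * r" by simp
  have t0: "0 < t" "t * (s / 2) = r" "2 / t = s / r" using assms(1) s2 by (auto simp: t_def)
  \<comment> \<open>\<open>t\<close> is the common value of \<open>p\<close> and \<open>q\<close> in the symmetric case \<open>1 / p = 1 / q\<close>.\<close>
  let ?A = "grid UNIV 1 :: (int ^ 'd) set" and ?C = "grid UNIV 2 :: (int ^ 'd) set"
  have f: "supported_in f ?A" using assms(5) by (simp add: unit_cube_eq_grid)
  let ?f = "\<lambda>x. \<bar>f x\<bar>"
  have le: "\<bar>convolution f f z\<bar> \<le> conv_on ?A ?f ?f z" for z
    by (intro convolution_le_conv_on finite_grid f)
  have "conv_on ?A ?f ?f z = 0" if "z \<notin> ?C" for z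
    using grid_add[of _ UNIV 1 _ 1] by (intro conv_on_eq_0[OF _ that]) auto
  then have sup: "supported_in (convolution f f) ?C"
    unfolding supported_in_def using le by (metis abs_le_zero_iff)
  have "(\<Sum>z\<in>?C. \<bar>convolution f f z\<bar> powr r) \<le> (\<Sum>z\<in>?C. conv_on ?A ?f ?f z powr r)"
    using assms(1) by (intro sum_mono powr_mono2 le) auto
  also have "\<dots> \<le> ((\<Sum>x\<in>?A. ?f x powr t) * (\<Sum>x\<in>?A. ?f x powr t)) powr (s / 2)"
    by (intro convolution_bound_grid two_point_inequality assms(1) t0 s s2 rs sr t_def) auto
  finally have "(\<Sum>z\<in>?C. \<bar>convolution f f z\<bar> powr r) powr (1 / r)
      \<le> (((\<Sum>x\<in>?A. ?f x powr t) * (\<Sum>x\<in>?A. ?f x powr t)) powr (s / 2)) powr (1 / r)"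
    using assms(1) by (intro powr_mono2) (auto intro: sum_nonneg)
  also have "\<dots> = (\<Sum>x\<in>?A. ?f x powr t) powr (2 / t)"
    by (simp add: powr_powr powr_mult powr_add[symmetric] t0(3) add_divide_distrib[symmetric])
  finally have "lp_norm (ereal r) (convolution f f) \<le> ereal ((\<Sum>x\<in>?A. ?f x powr t) powr (2 / t))"
    by (simp add: lp_norm_finite_support[OF finite_grid sup])
  also have "\<dots> \<le> lp_norm p f * lp_norm q f"
    using assms t0 s_def by (intro lp_norm_interpolation finite_grid f) auto
  finally show ?thesis .
qed

end
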